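(* The parameter set $3$-$(11,5,2)$ is admissible, but there is no $3$-$(11,5,2)$ block design.
   Context: A $t$-$(v,k,\lambda)$ (block) design is a set $D$ of $k$-element subsets (blocks) of a $v$-element set $V$ such that every $t$-element subset of $V$ is contained in exactly $\lambda$ blocks (blocks are not repeated). The parameter set $t$-$(v,k,\lambda)$ is admissible if $\lambda_i=\frac{\binom{v-i}{t-i}}{\binom{k-i}{t-i}}\lambda$ is an integer for all $i\in\{0,\ldots,t\}$. A parameter set is realizable if a design with these parameters exists. *)

theory Defs
  imports Complex_Main
begin

text \<open>The predicate \<open>block_design t v k l V D\<close> says that \<open>D\<close> is a \<open>t\<close>-\<open>(v,k,l)\<close> design on the
  point set \<open>V\<close>. As \<open>D\<close> is a set, blocks are not repeated.\<close>

definition block_design ::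
  "nat \<Rightarrow> nat \<Rightarrow> nat \<Rightarrow> nat \<Rightarrow> 'a set \<Rightarrow> 'a set set \<Rightarrow> bool" where
  "block_design t v k l V D \<longleftrightarrow>
     finite V \<and> card V = v \<and>
     (\<forall>B\<in>D. B \<subseteq> V \<and> card B = k) \<and>
     (\<forall>T. T \<subseteq> V \<and> card T = t \<longrightarrow> card {B \<in> D. T \<subseteq> B} = l)"

text \<open>Parameters are understood with \<open>t \<le> k \<le> v\<close>, so that the subtractions below do not truncate
  and the denominator is nonzero.\<close>

definition design_lambda :: "nat \<Rightarrow> nat \<Rightarrow> nat \<Rightarrow> nat \<Rightarrow> nat \<Rightarrow> rat" where
  "design_lambda t v k l i =
     of_nat ((v - i) choose (t - i)) / of_nat ((k - i) choose (t - i)) * of_nat l"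

definition admissible :: "nat \<Rightarrow> nat \<Rightarrow> nat \<Rightarrow> nat \<Rightarrow> bool" where
  "admissible t v k l \<longleftrightarrow> (\<forall>i\<in>{0..t}. design_lambda t v k l i \<in> \<int>)"

end

theory Submission
  imports Defs "HOL-Library.FuncSet"
begin

text \<open>Fix a block \<open>B\<close> and let \<open>n i\<close> be the number of other blocks that meet \<open>B\<close> in \<open>i\<close> points.
  Counting pairs \<open>(T, C)\<close> with \<open>T \<subseteq> B \<inter> C\<close>, \<open>card T = j\<close>, for \<open>j = 0, 1, 2, 3\<close> gives linear equations
  for \<open>n 0, \<dots>, n 4\<close>, which imply \<open>n 1 + 4 * n 4 = 0\<close> and \<open>n 0 = 2 + n 4\<close>. Hence no two blocks meet
  in \<open>4\<close> points, and two distinct blocks are disjoint from \<open>B\<close>. But these are \<open>5\<close>-subsets of the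
  \<open>6\<close>-point complement of \<open>B\<close>, so they meet in \<open>4\<close> points.\<close>

text \<open>Removing \<open>S\<close> turns these sets into the subsets of \<open>X - S\<close> of
  size \<open>t - card S\<close>; the bound on \<open>card S\<close> keeps this subtraction from
  truncating.\<close>

lemma card_subsets_between:
  assumes "finite X" "S \<subseteq> X" "card S \<le> t"
  shows "card {T. S \<subseteq> T \<and> T \<subseteq> X \<and> card T = t} = (card X - card S) choose (t - card S)"
proof -
  have fS: "finite S"
    using assms finite_subset by blast
  have "bij_betw (\<lambda>U. U \<union> S) {U. U \<subseteq> X - S \<and> card U = t - card S}
      {T. S \<subseteq> T \<and> T \<subseteq> X \<and> card T = t}"
  proof (rule bij_betwI[where g = "\<lambda>T. T - S"])
    have "card (U \<union> S) = t" if "U \<subseteq> X - S" "card U = t - card S" for U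
    proof -
      have "finite U" "U \<inter> S = {}"
        using that assms(1) finite_subset by auto
      then show ?thesis
        using that fS assms(3) by (simp add: card_Un_disjoint)
    qed
    then show "(\<lambda>U. U \<union> S) \<in> {U. U \<subseteq> X - S \<and> card U = t - card S} \<rightarrow>
        {T. S \<subseteq> T \<and> T \<subseteq> X \<and> card T = t}"
      using assms(2) by auto
    show "(\<lambda>T. T - S) \<in> {T. S \<subseteq> T \<and> T \<subseteq> X \<and> card T = t} \<rightarrow>
        {U. U \<subseteq> X - S \<and> card U = t - card S}"
      using fS by (auto simp: card_Diff_subset)
  qed auto
  then have "card {T. S \<subseteq> T \<and> T \<subseteq> X \<and> card T = t} = card {U. U \<subseteq> X - S \<and> card U = t - card S}"
    by (simp add: bij_betw_same_card)
  also have "\<dots> = card (X - S) choose (t - card S)"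
    using assms(1) by (simp add: n_subsets)
  finally show ?thesis
    using assms(2) fS by (simp add: card_Diff_subset)
qed

text \<open>Both sides count the pairs in \<open>R\<close>. This is the form in which every double
  count below is carried out.\<close>

lemma sum_card_swap:
  assumes "finite A" "finite B"
  shows "(\<Sum>x\<in>A. card {y \<in> B. R x y}) = (\<Sum>y\<in>B. card {x \<in> A. R x y})"
  using sum.swap_restrict[OF assms, of "\<lambda>_ _. 1::nat" R] by simp

lemma block_design_finite:
  assumes "block_design t v k l V D"
  shows "finite D"
  using assms unfolding block_design_def
  by (metis finite_Pow_iff finite_subset PowI subsetI)

text \<open>Double counting of the pairs \<open>(T, B)\<close> with
  \<open>S \<subseteq> T \<subseteq> B\<close> and \<open>card T = t\<close>. The product form
  avoids division on the naturals.\<close>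

lemma block_design_count_blocks:
  assumes "block_design t v k l V D" "S \<subseteq> V" "card S \<le> t"
  shows "card {B \<in> D. S \<subseteq> B} * ((k - card S) choose (t - card S))
    = ((v - card S) choose (t - card S)) * l"
proof -
  have D: "B \<subseteq> V" "card B = k" if "B \<in> D" for B
    using assms(1) that unfolding block_design_def by auto
  have finV: "finite V" and cV: "card V = v"
    using assms(1) unfolding block_design_def by auto
  define TT where "TT = {T. S \<subseteq> T \<and> T \<subseteq> V \<and> card T = t}"
  define DD where "DD = {B \<in> D. S \<subseteq> B}"
  have fin: "finite TT" "finite DD"
    using finV block_design_finite[OF assms(1)] unfolding TT_def DD_def by auto
  have "card {B \<in> DD. T \<subseteq> B} = l" if "T \<in> TT" for T
  proof -
    have "{B \<in> DD. T \<subseteq> B} = {B \<in> D. T \<subseteq> B}"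
      using that unfolding TT_def DD_def by blast
    then show ?thesis
      using that assms(1) unfolding TT_def block_design_def by simp
  qed
  moreover have "card {T \<in> TT. T \<subseteq> B} = (k - card S) choose (t - card S)" if "B \<in> DD" for B
  proof -
    have B: "B \<subseteq> V" "card B = k" "S \<subseteq> B" "finite B"
      using that D finite_subset[OF _ finV] unfolding DD_def by auto
    then have "{T \<in> TT. T \<subseteq> B} = {T. S \<subseteq> T \<and> T \<subseteq> B \<and> card T = t}"
      unfolding TT_def by blast
    then show ?thesis
      using card_subsets_between[OF B(4) B(3) assms(3)] B by simp
  qed
  ultimately have "card TT * l = card DD * ((k - card S) choose (t - card S))"
    using sum_card_swap[OF fin, of "\<lambda>T B. T \<subseteq> B"] by simp
  moreover have "card TT = (v - card S) choose (t - card S)"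
    using card_subsets_between[OF finV assms(2,3)] cV unfolding TT_def by simp
  ultimately show ?thesis
    unfolding DD_def by simp
qed

text \<open>The binomial coefficient counts the \<open>j\<close>-subsets \<open>T\<close> of
  \<open>X \<inter> C\<close>, so the sum counts pairs \<open>(T, C)\<close>; summing over
  \<open>T\<close> first gives the right-hand side.\<close>

lemma sum_choose_card_Int:
  assumes "finite X" "finite D" "\<And>T. T \<subseteq> X \<Longrightarrow> card T = j \<Longrightarrow> card {C \<in> D. T \<subseteq> C} = m"
  shows "(\<Sum>C\<in>D. card (X \<inter> C) choose j) = (card X choose j) * m"
proof -
  have "(card (X \<inter> C) choose j) = card {T \<in> {T. T \<subseteq> X \<and> card T = j}. T \<subseteq> C}" for C
  proof -
    have "{T \<in> {T. T \<subseteq> X \<and> card T = j}. T \<subseteq> C} = {T. T \<subseteq> X \<inter> C \<and> card T = j}"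
      by blast
    then show ?thesis
      using n_subsets[of "X \<inter> C" j] assms(1) by (metis finite_Int)
  qed
  then have "(\<Sum>C\<in>D. card (X \<inter> C) choose j)
      = (\<Sum>T\<in>{T. T \<subseteq> X \<and> card T = j}. card {C \<in> D. T \<subseteq> C})"
    using sum_card_swap[of "{T. T \<subseteq> X \<and> card T = j}" D "\<lambda>T C. T \<subseteq> C"] assms(1,2) by simp
  also have "\<dots> = (card X choose j) * m"
    using assms(1,3) by (simp add: n_subsets)
  finally show ?thesis .
qed

lemma sum_by_value:
  fixes g :: "'b \<Rightarrow> nat" and f :: "nat \<Rightarrow> nat"
  assumes "finite A" "\<And>x. x \<in> A \<Longrightarrow> g x \<le> m"
  shows "(\<Sum>x\<in>A. f (g x)) = (\<Sum>i\<le>m. f i * card {x \<in> A. g x = i})"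
proof -
  have "(\<Sum>x\<in>A. f (g x)) = (\<Sum>i\<le>m. \<Sum>x\<in>{x \<in> A. g x = i}. f (g x))"
    using assms by (intro sum.group[symmetric]) auto
  then show ?thesis
    by (simp add: mult.commute)
qed

lemma no_block_design_3_11_5_2: "\<not> block_design 3 11 5 2 V D"
proof
  assume des: "block_design 3 11 5 2 V D"
  have V: "finite V" "card V = 11"
    using des unfolding block_design_def by auto
  have D: "B \<subseteq> V" "card B = 5" "finite B" if "B \<in> D" for B
    using des that V finite_subset unfolding block_design_def by auto
  have fD: "finite D"
    using block_design_finite[OF des] .
  \<comment> \<open>The entries are 2 * 165 / 10, 2 * 45 / 6, 2 * 9 / 3 and 2, the values of
    \<open>design_lambda\<close> for \<open>i = 0, \<dots>, 3\<close>.\<close>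
  have lam: "card {B \<in> D. S \<subseteq> B} = [33, 15, 6, 2] ! card S" if "S \<subseteq> V" "card S \<le> 3" for S
  proof -
    have "card S \<in> {0, 1, 2, 3}"
      using that(2) by auto
    then show ?thesis
      using block_design_count_blocks[OF des that]
      by (auto simp: choose_reduce_nat)
  qed
  \<comment> \<open>Needed for two blocks: the first count at an arbitrary \<open>B\<close>, the
    second at a block \<open>C\<close> disjoint from it.\<close>
  have intersections: "card {C \<in> D. C \<noteq> B \<and> card (B \<inter> C) = 0} = 2
      \<and> card {C \<in> D. C \<noteq> B \<and> card (B \<inter> C) = 4} = 0" if B: "B \<in> D" for B
  proof -
    define n where "n i = card {C \<in> D - {B}. card (B \<inter> C) = i}" for i
    have le: "card (B \<inter> C) \<le> 4" if C: "C \<in> D - {B}" for C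
    proof -
      have "B \<inter> C \<noteq> B"
        using C D B card_subset_eq by (metis DiffE Int_lower2 singletonI)
      then have "card (B \<inter> C) < card B"
        using D(3)[OF B] by (metis Int_lower1 psubset_card_mono psubsetI)
      then show ?thesis
        using D(2)[OF B] by simp
    qed
    \<comment> \<open>The summand \<open>5 choose j\<close> is the contribution of \<open>B\<close>
      itself, which \<open>n\<close> leaves out.\<close>
    have eq: "(\<Sum>i\<le>4. (i choose j) * n i) + (5 choose j) = (5 choose j) * [33, 15, 6, 2] ! j"
      if "j \<le> 3" for j
    proof -
      have "(\<Sum>C\<in>D. card (B \<inter> C) choose j) = (card B choose j) * [33, 15, 6, 2] ! j"
        using D[OF B] fD lam that by (intro sum_choose_card_Int) auto
      moreover have "(\<Sum>C\<in>D. card (B \<inter> C) choose j)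
          = (\<Sum>C\<in>D - {B}. card (B \<inter> C) choose j) + (5 choose j)"
        using sum.remove[OF fD B, of "\<lambda>C. card (B \<inter> C) choose j"] D(2)[OF B] by simp
      moreover have "(\<Sum>C\<in>D - {B}. card (B \<inter> C) choose j) = (\<Sum>i\<le>4. (i choose j) * n i)"
        unfolding n_def using fD le
        by (intro sum_by_value[where f = "\<lambda>i. i choose j"]) auto
      ultimately show ?thesis
        using D(2)[OF B] by simp
    qed
    have atMost_4: "{..4} = {0, 1, 2, 3, 4::nat}"
      by auto
    \<comment> \<open>The system has right-hand sides 32, 70, 50, 10. Elimination from the last
      equation upwards gives \<open>n 3 = 10 - 4 * n 4\<close>, \<open>n 2 = 20 + 6 * n 4\<close>
      and \<open>n 1 + 4 * n 4 = 0\<close>; the last forces \<open>n 4 = 0\<close> since both terms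
      are natural numbers.\<close>
    have "n 0 = 2 \<and> n 4 = 0"
      using eq[of 0] eq[of 1] eq[of 2] eq[of 3]
      by (simp add: choose_reduce_nat binomial_eq_0 atMost_4)
    moreover have "{C \<in> D - {B}. card (B \<inter> C) = i} = {C \<in> D. C \<noteq> B \<and> card (B \<inter> C) = i}" for i
      by blast
    ultimately show ?thesis
      unfolding n_def by simp
  qed
  have "card D = 33"
    using lam[of "{}"] by simp
  then obtain B where B: "B \<in> D"
    by fastforce
  obtain C C' where CC: "{C \<in> D. C \<noteq> B \<and> card (B \<inter> C) = 0} = {C, C'}" "C \<noteq> C'"
    using intersections[OF B] by (auto simp: card_2_iff)
  have "C \<in> {C \<in> D. C \<noteq> B \<and> card (B \<inter> C) = 0}" "C' \<in> {C \<in> D. C \<noteq> B \<and> card (B \<inter> C) = 0}"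
    unfolding CC(1) by auto
  then have C: "C \<in> D" "C' \<in> D" "B \<inter> C = {}" "B \<inter> C' = {}"
    using D(3)[OF B] by simp_all
  have "card (V - B) = 6"
    using D[OF B] V by (simp add: card_Diff_subset)
  moreover have "C \<union> C' \<subseteq> V - B"
    using C D(1) by blast
  ultimately have "card (C \<union> C') \<le> 6"
    using V by (metis card_mono finite_Diff)
  then have ge: "card (C \<inter> C') \<ge> 4"
    using card_Un_Int[of C C'] C(1,2) D by simp
  \<comment> \<open>Distinct blocks of size 5 share at most 4 points, so here exactly 4, against the
    second count at \<open>C\<close>.\<close>
  have "C \<inter> C' \<noteq> C"
    using C(1,2) CC(2) D by (metis Int_lower2 card_subset_eq)
  then have "card (C \<inter> C') < card C"
    using D(3)[OF C(1)] by (metis Int_lower1 psubset_card_mono psubsetI)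
  then have "C' \<in> {X \<in> D. X \<noteq> C \<and> card (C \<inter> X) = 4}"
    using ge C(2) D(2)[OF C(1)] CC(2) by auto
  moreover have "finite {X \<in> D. X \<noteq> C \<and> card (C \<inter> X) = 4}"
    using fD by simp
  ultimately show False
    using intersections[OF C(1)] by (metis card_0_eq empty_iff)
qed

lemma admissible_3_11_5_2: "admissible 3 11 5 2"
proof -
  have "design_lambda 3 11 5 2 0 = of_int 33" "design_lambda 3 11 5 2 1 = of_int 15"
    "design_lambda 3 11 5 2 2 = of_int 6" "design_lambda 3 11 5 2 3 = of_int 2"
    by (simp_all add: design_lambda_def choose_reduce_nat)
  moreover have "{0..3} = {0, 1, 2, 3::nat}"
    by auto
  ultimately show ?thesis
    \<comment> \<open>The values must stay in the form \<open>of_int\<close>, which shows that they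
      are integers.\<close>
    unfolding admissible_def by (simp del: of_int_numeral)
qed

theorem theorem3p1:
  shows "admissible 3 11 5 2 \<and>
    \<not> (\<exists>(V :: 'a set) (D :: 'a set set). block_design 3 11 5 2 V D)"
  using admissible_3_11_5_2 no_block_design_3_11_5_2 by blast

end
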